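(* For $n\ge1$, the normalized median Genocchi number $h_{n+1}$ satisfies $$h_{n+1}=\sum_{\mathbf{f}\in M_{n+1}}\frac{\prod_{k=1}^n(1+f_k)^2}{2^{l(\mathbf{f})}},$$ where $M_{n+1}$ is the set of Motzkin paths from $(0,0)$ to $(n+1,0)$ and $l(\mathbf{f})$ is the number of rises plus the number of falls of $\mathbf{f}$.
   Context: The normalized median Genocchi number $h_m$ is the number of collections $(S_1,\dots,S_{m-1})$ of subsets $S_i\subset\{1,\dots,m\}$ with $\#S_i=i$ for $1\le i\le m-1$ and $S_i\subset S_{i+1}\cup\{i+1\}$ for $1\le i\le m-2$. For $m=1,2,3,4,5$ these numbers are $1,2,7,38,295$. A Motzkin path $\mathbf{f}\in M_{n+1}$ is a sequence of non-negative integers $(f_0,f_1,\dots,f_{n+1})$ with $f_0=f_{n+1}=0$ and $f_{i+1}-f_i\in\{-1,0,1\}$ for $0\le i\le n$. A rise is an index $0\le i\le n$ with $f_{i+1}=f_i+1$, and a fall is an index $0\le i\le n$ with $f_{i+1}=f_i-1$. *)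

theory Defs
  imports Complex_Main "HOL-Library.FuncSet"
begin

text \<open>
  Collections and paths are extensional functions on their index sets, so that each
  finite sequence is represented by exactly one function.
\<close>

definition genocchi_collections :: "nat \<Rightarrow> (nat \<Rightarrow> nat set) set" where
  "genocchi_collections m =
     {S \<in> {1..m - 1} \<rightarrow>\<^sub>E Pow {1..m}.
        (\<forall>i\<in>{1..m - 1}. card (S i) = i) \<and>
        (\<forall>i\<in>{1..m - 2}. S i \<subseteq> S (i + 1) \<union> {i + 1})}"

definition normalized_median_genocchi :: "nat \<Rightarrow> nat" where
  "normalized_median_genocchi m = card (genocchi_collections m)"

definition motzkin_paths :: "nat \<Rightarrow> (nat \<Rightarrow> nat) set" where
  "motzkin_paths N =
     {f \<in> {0..N} \<rightarrow>\<^sub>E UNIV.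
        f 0 = 0 \<and> f N = 0 \<and>
        (\<forall>i<N. int (f (i + 1)) - int (f i) \<in> {-1, 0, 1})}"

definition rises :: "nat \<Rightarrow> (nat \<Rightarrow> nat) \<Rightarrow> nat set" where
  "rises N f = {i. i < N \<and> int (f (i + 1)) = int (f i) + 1}"

definition falls :: "nat \<Rightarrow> (nat \<Rightarrow> nat) \<Rightarrow> nat set" where
  "falls N f = {i. i < N \<and> int (f (i + 1)) = int (f i) - 1}"

definition num_rises_falls :: "nat \<Rightarrow> (nat \<Rightarrow> nat) \<Rightarrow> nat" where
  "num_rises_falls N f = card (rises N f) + card (falls N f)"

text \<open>
  Finiteness of the two index sets, so that neither \<^term>\<open>card\<close> nor the sum over
  \<^term>\<open>motzkin_paths N\<close> takes its default value.
\<close>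

lemma finite_genocchi_collections: "finite (genocchi_collections m)"
proof -
  have "finite ({1..m - 1} \<rightarrow>\<^sub>E Pow {1..m})"
    by (intro finite_PiE) auto
  then show ?thesis
    unfolding genocchi_collections_def by (rule finite_subset[rotated]) blast
qed

lemma motzkin_path_le:
  assumes "f \<in> motzkin_paths N" "i \<le> N"
  shows "f i \<le> i"
  using assms(2)
proof (induction i)
  case 0
  then show ?case using assms(1) by (simp add: motzkin_paths_def)
next
  case (Suc i)
  then have "int (f (i + 1)) - int (f i) \<in> {-1, 0, 1}"
    using assms(1) by (simp add: motzkin_paths_def)
  with Suc show ?case by auto
qed

lemma finite_motzkin_paths: "finite (motzkin_paths N)"
proof (rule finite_subset)
  show "motzkin_paths N \<subseteq> {0..N} \<rightarrow>\<^sub>E {0..N}"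
  proof
    fix f assume f: "f \<in> motzkin_paths N"
    then have "f \<in> extensional {0..N}"
      by (simp add: motzkin_paths_def PiE_def)
    moreover have "f i \<in> {0..N}" if "i \<in> {0..N}" for i
      using motzkin_path_le[OF f, of i] that by simp
    ultimately show "f \<in> {0..N} \<rightarrow>\<^sub>E {0..N}"
      by (auto simp: PiE_def)
  qed
  show "finite ({0..N} \<rightarrow>\<^sub>E {0..N})"
    by (intro finite_PiE) auto
qed

end

theory Submission
  imports Defs
begin

text \<open>
  Extend a collection by \<open>S 0 = {}\<close> and \<open>S m = {1..m}\<close>, and record \<open>S i\<close> by its defect
  \<open>B i = {1..i} - S i\<close> and its excess \<open>T i = S i - {1..i}\<close>. Then \<open>card (S i) = i\<close> says
  that \<open>B i\<close> and \<open>T i\<close> have the same cardinality \<open>f i\<close>, and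
  \<open>S i \<subseteq> S (i + 1) \<union> {i + 1}\<close> falls apart into the two independent conditions
  \<open>B (i + 1) \<subseteq> B i \<union> {i + 1}\<close> and \<open>T i \<subseteq> T (i + 1) \<union> {i + 1}\<close>. The
  first lets \<open>f\<close> rise by at most one per step and the second lets it fall by at most one, so \<open>f\<close> is a Motzkin path.

  For a fixed path \<open>f\<close> the two families are chosen separately. Going upwards, \<open>B (i + 1)\<close>
  is an arbitrary \<open>f (i + 1)\<close>-element subset of a set with \<open>f i + 1\<close> elements; going
  downwards, \<open>T i\<close> is an arbitrary \<open>f i\<close>-element subset of a set with \<open>f (i + 1) + 1\<close>
  elements. Hence \<open>f\<close> arises from
  \[ \prod_i {f_i + 1 \choose f_{i+1}} {f_{i+1} + 1 \choose f_i} \]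
  collections. The factor for a step from \<open>a\<close> to \<open>b\<close> is \<open>(1 + a) (1 + b)\<close>, halved when
  \<open>a \<noteq> b\<close>. In the product every inner height contributes its \<open>1 + f k\<close> twice, which gives
  the stated weight of \<open>f\<close>.
\<close>

section \<open>Chains that gain at most one prescribed element per step\<close>

text \<open>
  Both the defects, read upwards, and the excesses, read downwards, form such a chain: at step
  \<open>i\<close> elements may be dropped freely, but only \<open>e i\<close> may enter.
\<close>

definition slow_chains :: "(nat \<Rightarrow> 'a) \<Rightarrow> nat \<Rightarrow> (nat \<Rightarrow> nat) \<Rightarrow> (nat \<Rightarrow> 'a set) set" where
  "slow_chains e N f =
     {X \<in> {0..N} \<rightarrow>\<^sub>E UNIV. X 0 = {} \<and> (\<forall>i<N. X (Suc i) \<subseteq> insert (e i) (X i)) \<and>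
        (\<forall>i\<le>N. card (X i) = f i)}"

lemma slow_chain_subset:
  assumes "X \<in> slow_chains e N f" "i \<le> N"
  shows "X i \<subseteq> e ` {..<i}"
  using assms(2)
proof (induction i)
  case 0
  then show ?case using assms(1) by (simp add: slow_chains_def)
next
  case (Suc i)
  then have "X (Suc i) \<subseteq> insert (e i) (X i)"
    using assms(1) by (simp add: slow_chains_def)
  also have "\<dots> \<subseteq> insert (e i) (e ` {..<i})"
    using Suc by auto
  finally show ?case by (simp add: lessThan_Suc)
qed

lemma slow_chain_0:
  assumes "X \<in> slow_chains e N f"
  shows "f 0 = 0"
proof -
  from assms have "X 0 = {}" "\<forall>i\<le>N. card (X i) = f i"
    by (simp_all add: slow_chains_def)
  from this(2)[rule_format, of 0] this(1) show ?thesis by simp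
qed

lemma finite_slow_chain:
  assumes "X \<in> slow_chains e N f" "i \<le> N"
  shows "finite (X i)"
  using slow_chain_subset[OF assms] by (rule finite_subset) simp

lemma slow_chain_step:
  assumes "X \<in> slow_chains e N f" "i < N"
  shows "f (Suc i) \<le> Suc (f i)"
proof -
  have "X (Suc i) \<subseteq> insert (e i) (X i)"
    using assms by (simp add: slow_chains_def)
  moreover have "finite (insert (e i) (X i))"
    using finite_slow_chain[OF assms(1), of i] assms(2) by simp
  ultimately have "card (X (Suc i)) \<le> card (insert (e i) (X i))"
    by (rule card_mono[rotated])
  also have "\<dots> \<le> Suc (card (X i))"
    by (rule card_insert_le_m1) auto
  finally show ?thesis using assms by (simp add: slow_chains_def)
qed

lemma slow_chains_0:
  assumes "f 0 = 0"
  shows "slow_chains e 0 f = {\<lambda>i\<in>{0}. {}}"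
  using assms by (auto simp: slow_chains_def PiE_def extensional_def fun_eq_iff)

lemma bij_betw_slow_chains_Suc:
  "bij_betw (\<lambda>(X, Y). X(Suc N := Y))
     (Sigma (slow_chains e N f) (\<lambda>X. {Y. Y \<subseteq> insert (e N) (X N) \<and> card Y = f (Suc N)}))
     (slow_chains e (Suc N) f)"
  (is "bij_betw ?h ?A ?B")
proof (rule bij_betw_byWitness[where f' = "\<lambda>X. (restrict X {0..N}, X (Suc N))"])
  show "\<forall>p\<in>?A. (\<lambda>X. (restrict X {0..N}, X (Suc N))) (?h p) = p"
    by (auto simp: slow_chains_def fun_eq_iff PiE_def extensional_def)
  show "\<forall>X\<in>?B. ?h (restrict X {0..N}, X (Suc N)) = X"
    by (auto simp: slow_chains_def fun_eq_iff PiE_def extensional_def)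
  show "?h ` ?A \<subseteq> ?B"
  proof clarify
    fix X Y
    assume X: "X \<in> slow_chains e N f" and Y: "Y \<subseteq> insert (e N) (X N)" "card Y = f (Suc N)"
    have "(X(Suc N := Y)) (Suc i) \<subseteq> insert (e i) ((X(Suc N := Y)) i)" if "i < Suc N" for i
      using X Y that by (cases "i = N") (simp_all add: slow_chains_def)
    moreover have "card ((X(Suc N := Y)) i) = f i" if "i \<le> Suc N" for i
      using X Y that by (cases "i = Suc N") (simp_all add: slow_chains_def)
    ultimately show "X(Suc N := Y) \<in> slow_chains e (Suc N) f"
      using X by (simp add: slow_chains_def PiE_def extensional_def)
  qed
  show "(\<lambda>X. (restrict X {0..N}, X (Suc N))) ` ?B \<subseteq> ?A"
    by (simp add: slow_chains_def image_subset_iff)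
qed

text \<open>
  Injectivity of \<open>e\<close> makes the entering element new, so that each step selects from a set
  with exactly \<open>f i + 1\<close> elements.
\<close>

lemma card_slow_chains:
  assumes "inj_on e {..<N}" "f 0 = 0"
  shows "finite (slow_chains e N f) \<and>
    card (slow_chains e N f) = (\<Prod>i<N. (f i + 1) choose f (Suc i))"
  using assms(1)
proof (induction N)
  case 0
  then show ?case using assms(2) by (simp add: slow_chains_0)
next
  case (Suc N)
  let ?Y = "\<lambda>X. {Y. Y \<subseteq> insert (e N) (X N) \<and> card Y = f (Suc N)}"
  have "inj_on e {..<N}"
    using Suc.prems by (rule inj_on_subset) auto
  then have IH: "finite (slow_chains e N f)"
      "card (slow_chains e N f) = (\<Prod>i<N. (f i + 1) choose f (Suc i))"
    using Suc.IH by auto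
  have Y: "finite (?Y X) \<and> card (?Y X) = (f N + 1) choose f (Suc N)"
    if X: "X \<in> slow_chains e N f" for X
  proof -
    have "e N \<notin> e ` {..<N}"
      using inj_on_image_mem_iff[OF Suc.prems, of N "{..<N}"] by simp
    then have "e N \<notin> X N"
      using slow_chain_subset[OF X order_refl] by blast
    moreover have "finite (X N)"
      using X by (rule finite_slow_chain) simp
    moreover have "card (X N) = f N"
      using X by (simp add: slow_chains_def)
    ultimately show ?thesis
      using n_subsets[of "insert (e N) (X N)" "f (Suc N)"] by simp
  qed
  note bij = bij_betw_slow_chains_Suc[of N e f]
  have "finite (Sigma (slow_chains e N f) ?Y)"
    using IH(1) Y by (intro finite_SigmaI) auto
  moreover have "card (Sigma (slow_chains e N f) ?Y) =
      (\<Prod>i<Suc N. (f i + 1) choose f (Suc i))"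
    using IH Y by (simp add: card_SigmaI)
  ultimately show ?case
    using bij_betw_finite[OF bij] bij_betw_same_card[OF bij] by simp
qed

section \<open>Splitting a collection into defects and excesses\<close>

text \<open>
  The excesses are read backwards: entry \<open>j\<close> is \<open>T (m - j)\<close>, and the element that may
  enter with entry \<open>j + 1\<close> is \<open>m - j\<close>. Both components must have the same path of
  cardinalities.
\<close>

definition defect_excess_pairs ::
    "nat \<Rightarrow> (nat \<Rightarrow> nat) \<Rightarrow> ((nat \<Rightarrow> nat set) \<times> (nat \<Rightarrow> nat set)) set" where
  "defect_excess_pairs m f =
     slow_chains Suc m f \<times> slow_chains (\<lambda>j. m - j) m (\<lambda>j. f (m - j))"

text \<open>
  With the entries \<open>{}\<close> at \<open>0\<close> and \<open>{1..m}\<close> at \<open>m\<close>, which are forced by the cardinality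
  condition, defects and excesses are empty at both ends. This is why the path starts and ends
  at height \<open>0\<close>.
\<close>

definition extend_collection :: "nat \<Rightarrow> (nat \<Rightarrow> nat set) \<Rightarrow> nat \<Rightarrow> nat set" where
  "extend_collection m S i = (if i = 0 then {} else if i = m then {1..m} else S i)"

definition split_collection ::
    "nat \<Rightarrow> (nat \<Rightarrow> nat set) \<Rightarrow> (nat \<Rightarrow> nat set) \<times> (nat \<Rightarrow> nat set)" where
  "split_collection m S =
     (\<lambda>i\<in>{0..m}. {1..i} - extend_collection m S i,
      \<lambda>j\<in>{0..m}. extend_collection m S (m - j) - {1..m - j})"

definition merge_pair ::
    "nat \<Rightarrow> (nat \<Rightarrow> nat set) \<times> (nat \<Rightarrow> nat set) \<Rightarrow> nat \<Rightarrow> nat set" where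
  "merge_pair m p = (\<lambda>i\<in>{1..m - 1}. ({1..i} - fst p i) \<union> snd p (m - i))"

lemma extend_collection_props:
  assumes "S \<in> genocchi_collections m"
  shows "i \<le> m \<Longrightarrow> extend_collection m S i \<subseteq> {1..m}"
    and "i \<le> m \<Longrightarrow> card (extend_collection m S i) = i"
    and "i < m \<Longrightarrow> extend_collection m S i \<subseteq> insert (Suc i) (extend_collection m S (Suc i))"
proof -
  have "S i \<subseteq> {1..m}" if "i \<in> {1..m - 1}" for i
    using assms PiE_mem[OF _ that, of S "\<lambda>_. Pow {1..m}"] by (simp add: genocchi_collections_def)
  then show sub: "i \<le> m \<Longrightarrow> extend_collection m S i \<subseteq> {1..m}" for i
    by (simp add: extend_collection_def)
  show "i \<le> m \<Longrightarrow> card (extend_collection m S i) = i"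
    using assms by (auto simp: genocchi_collections_def extend_collection_def)
  assume "i < m"
  show "extend_collection m S i \<subseteq> insert (Suc i) (extend_collection m S (Suc i))"
    \<comment> \<open>At either end of the extended collection the inclusion is automatic.\<close>
  proof (cases "i = 0 \<or> Suc i = m")
    case True
    then show ?thesis
      using sub[of i] \<open>i < m\<close> by (auto simp: extend_collection_def)
  next
    case False
    then have "i \<in> {1..m - 2}" using \<open>i < m\<close> by auto
    then have "S i \<subseteq> S (i + 1) \<union> {i + 1}"
      using assms by (simp add: genocchi_collections_def)
    then show ?thesis
      using False \<open>i < m\<close> by (auto simp: extend_collection_def)
  qed
qed

lemma card_defect_eq_card_excess:
  assumes "finite A" "card A = i"
  shows "card ({1..i} - A) = card (A - {1..i})"
proof -
  have "card ({1..i} - A) = i - card ({1..i} \<inter> A)"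
    by (simp add: card_Diff_subset_Int)
  moreover have "card (A - {1..i}) = i - card (A \<inter> {1..i})"
    using assms by (simp add: card_Diff_subset_Int)
  ultimately show ?thesis by (simp add: Int_commute)
qed

text \<open>
  The two chains bound the same cardinalities from opposite ends: the defects keep \<open>f\<close>
  from rising by more than one, and the excesses, being read backwards, from falling by more
  than one.
\<close>

lemma motzkin_pathI_defect_excess:
  assumes "(B, T) \<in> defect_excess_pairs m f" "f \<in> extensional {0..m}"
  shows "f \<in> motzkin_paths m"
proof -
  from assms(1) have B: "B \<in> slow_chains Suc m f"
    and T: "T \<in> slow_chains (\<lambda>j. m - j) m (\<lambda>j. f (m - j))"
    by (auto simp: defect_excess_pairs_def)
  have "f 0 = 0"
    using slow_chain_0[OF B] .
  moreover have "f m = 0"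
    using slow_chain_0[OF T] by simp
  moreover have "int (f (i + 1)) - int (f i) \<in> {-1, 0, 1}" if i: "i < m" for i
  proof -
    have "f (Suc i) \<le> Suc (f i)"
      using slow_chain_step[OF B i] .
    moreover have "f i \<le> Suc (f (Suc i))"
      using slow_chain_step[OF T, of "m - Suc i"] i by (simp add: Suc_diff_Suc)
    ultimately show ?thesis by auto
  qed
  ultimately show ?thesis
    using assms(2) by (auto simp: motzkin_paths_def PiE_def)
qed

lemma split_collection_mem:
  assumes "S \<in> genocchi_collections m"
  shows "\<exists>f\<in>motzkin_paths m. split_collection m S \<in> defect_excess_pairs m f"
proof -
  define E where "E = extend_collection m S"
  define f where "f = (\<lambda>i\<in>{0..m}. card ({1..i} - E i))"
  note E = extend_collection_props[OF assms, folded E_def]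
  have fin: "finite (E i)" if "i \<le> m" for i
    using E(1)[OF that] by (rule finite_subset) simp
  have "{1..Suc i} - E (Suc i) \<subseteq> insert (Suc i) ({1..i} - E i)" if "i < m" for i
    using E(3)[OF that] by auto
  then have "fst (split_collection m S) \<in> slow_chains Suc m f"
    by (simp add: slow_chains_def split_collection_def f_def E_def[symmetric])
  moreover have "snd (split_collection m S) \<in> slow_chains (\<lambda>j. m - j) m (\<lambda>j. f (m - j))"
  proof -
    have "E m = {1..m}"
      by (auto simp: E_def extend_collection_def)
    moreover have "E (m - Suc j) - {1..m - Suc j} \<subseteq> insert (m - j) (E (m - j) - {1..m - j})"
      if "j < m" for j
    proof -
      have "Suc (m - Suc j) = m - j" using that by simp
      moreover from this have "{1..m - j} = insert (m - j) {1..m - Suc j}"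
        by (metis Icc_eq_insert_lb_nat atLeastAtMostSuc_conv le_add1 plus_1_eq_Suc)
      ultimately show ?thesis using E(3)[of "m - Suc j"] that by auto
    qed
    moreover have "card (E (m - j) - {1..m - j}) = card ({1..m - j} - E (m - j))" for j
      using card_defect_eq_card_excess[OF fin E(2)] by simp
    ultimately show ?thesis
      by (simp add: slow_chains_def split_collection_def f_def E_def[symmetric])
  qed
  ultimately have "split_collection m S \<in> defect_excess_pairs m f"
    by (simp add: defect_excess_pairs_def mem_Times_iff)
  moreover from this have "f \<in> motzkin_paths m"
    by (intro motzkin_pathI_defect_excess[of "fst (split_collection m S)"
          "snd (split_collection m S)"]) (simp_all add: f_def)
  ultimately show ?thesis by blast
qed

lemma defect_excess_pair_bounds:
  assumes "(B, T) \<in> defect_excess_pairs m f" "i \<le> m"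
  shows "B i \<subseteq> {1..i}" and "T (m - i) \<subseteq> {Suc i..m}"
    and "card (B i) = f i" and "card (T (m - i)) = f i"
proof -
  from assms(1) have B: "B \<in> slow_chains Suc m f"
    and T: "T \<in> slow_chains (\<lambda>j. m - j) m (\<lambda>j. f (m - j))"
    by (auto simp: defect_excess_pairs_def)
  show "B i \<subseteq> {1..i}"
    using slow_chain_subset[OF B assms(2)] by fastforce
  show "T (m - i) \<subseteq> {Suc i..m}"
    using slow_chain_subset[OF T, of "m - i"] assms(2) by fastforce
  show "card (B i) = f i"
    using B assms(2) by (simp add: slow_chains_def)
  show "card (T (m - i)) = f i"
    using T assms(2) by (simp add: slow_chains_def)
qed

lemma merge_pair_mem:
  assumes "p \<in> defect_excess_pairs m f"
  shows "merge_pair m p \<in> genocchi_collections m"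
proof -
  obtain B T where p: "p = (B, T)" by force
  note bounds = defect_excess_pair_bounds[OF assms[unfolded p]]
  have B: "B (Suc i) \<subseteq> insert (Suc i) (B i)" if "i < m" for i
    using assms that by (simp add: p defect_excess_pairs_def slow_chains_def)
  have T: "T (m - i) \<subseteq> insert (Suc i) (T (m - Suc i))" if i: "i < m" for i
  proof -
    have "\<forall>j<m. T (Suc j) \<subseteq> insert (m - j) (T j)"
      using assms by (simp add: p defect_excess_pairs_def slow_chains_def)
    from this[rule_format, of "m - Suc i"] show ?thesis
      using i by (simp add: Suc_diff_Suc)
  qed
  have "card (({1..i} - B i) \<union> T (m - i)) = i" if i: "i \<le> m" for i
  proof -
    note b = bounds[OF i]
    have fin: "finite (B i)" "finite (T (m - i))"
      using b(1,2) by (auto intro: finite_subset)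
    have "f i \<le> i"
      using card_mono[OF _ b(1)] b(3) by simp
    moreover have "card (({1..i} - B i) \<union> T (m - i)) = card ({1..i} - B i) + card (T (m - i))"
      using b(2) fin by (intro card_Un_disjoint) auto
    moreover have "card ({1..i} - B i) = i - f i"
      using b(1,3) fin by (simp add: card_Diff_subset)
    ultimately show ?thesis using b(4) by simp
  qed
  moreover have "({1..i} - B i) \<union> T (m - i) \<subseteq> {1..m}" if i: "i \<le> m" for i
    using bounds(2)[OF i] i by auto
  moreover have "({1..i} - B i) \<union> T (m - i)
      \<subseteq> ({1..Suc i} - B (Suc i)) \<union> T (m - Suc i) \<union> {Suc i}" if "i < m" for i
    using B[OF that] T[OF that] by auto
  moreover define M where "M = (\<lambda>i. ({1..i} - B i) \<union> T (m - i))"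
  ultimately have M: "i \<le> m \<Longrightarrow> card (M i) = i" "i \<le> m \<Longrightarrow> M i \<subseteq> {1..m}"
    "i < m \<Longrightarrow> M i \<subseteq> M (i + 1) \<union> {i + 1}" for i
    by simp_all
  have "merge_pair m p = restrict M {1..m - 1}"
    by (simp add: merge_pair_def M_def p)
  moreover have "restrict M {1..m - 1} \<in> {1..m - 1} \<rightarrow>\<^sub>E Pow {1..m}"
  proof -
    have "M i \<in> Pow {1..m}" if "i \<in> {1..m - 1}" for i
      using that by (intro PowI M(2)) auto
    then show ?thesis by (simp add: restrict_PiE_iff)
  qed
  moreover have "restrict M {1..m - 1} i \<subseteq> restrict M {1..m - 1} (i + 1) \<union> {i + 1}"
    if "i \<in> {1..m - 2}" for i
  proof -
    have "i \<in> {1..m - 1}" "i + 1 \<in> {1..m - 1}" "i < m"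
      using that by auto
    then show ?thesis
      using M(3) by (simp only: restrict_apply if_True)
  qed
  moreover have "card (restrict M {1..m - 1} i) = i" if "i \<in> {1..m - 1}" for i
    using that M(1)[of i] by auto
  ultimately show ?thesis
    unfolding genocchi_collections_def by (intro CollectI conjI ballI) simp_all
qed

lemma merge_split_collection:
  assumes "S \<in> genocchi_collections m"
  shows "merge_pair m (split_collection m S) = S"
proof
  fix i
  show "merge_pair m (split_collection m S) i = S i"
  proof (cases "i \<in> {1..m - 1}")
    case True
    then have "extend_collection m S i = S i" "m - (m - i) = i" "i \<le> m"
      by (auto simp: extend_collection_def)
    with True have "merge_pair m (split_collection m S) i = {1..i} - ({1..i} - S i) \<union> (S i - {1..i})"
      by (simp add: merge_pair_def split_collection_def)
    then show ?thesis by auto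
  next
    case False
    then show ?thesis
      using assms by (auto simp: merge_pair_def genocchi_collections_def PiE_def extensional_def)
  qed
qed

lemma split_merge_pair:
  assumes "p \<in> defect_excess_pairs m f" "f \<in> motzkin_paths m"
  shows "split_collection m (merge_pair m p) = p"
proof -
  obtain B T where p: "p = (B, T)" by force
  note mem = assms(1)[unfolded p]
  note bounds = defect_excess_pair_bounds[OF mem]
  have f: "f 0 = 0" "f m = 0"
    using assms(2) by (auto simp: motzkin_paths_def)
  have ext: "B \<in> extensional {0..m}" "T \<in> extensional {0..m}"
    using mem by (simp_all add: defect_excess_pairs_def slow_chains_def PiE_def)
  have "finite (B m)" "finite (T m)"
    using bounds(1)[of m] bounds(2)[of 0] by (auto intro: finite_subset)
  then have Bm: "B m = {}" and Tm: "T m = {}"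
    using bounds(3)[of m] bounds(4)[of 0] f by simp_all
  have B0: "B 0 = {}" and T0: "T 0 = {}"
    using mem by (simp_all add: defect_excess_pairs_def slow_chains_def)
  have E: "extend_collection m (merge_pair m p) i = ({1..i} - B i) \<union> T (m - i)"
    if "i \<le> m" for i
    using that Bm Tm B0 T0 by (auto simp: extend_collection_def merge_pair_def p)
  have "{1..i} - extend_collection m (merge_pair m p) i = B i" if i: "i \<le> m" for i
    unfolding E[OF i] using bounds(1,2)[OF i] by fastforce
  then have "fst (split_collection m (merge_pair m p)) = B"
    using ext(1) by (intro extensionalityI[of _ "{0..m}"]) (simp_all add: split_collection_def)
  moreover have "extend_collection m (merge_pair m p) i - {1..i} = T (m - i)"
    if i: "i \<le> m" for i
    unfolding E[OF i] using bounds(1,2)[OF i] by fastforce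
  from this[of "m - j" for j] have "snd (split_collection m (merge_pair m p)) = T"
    using ext(2) by (intro extensionalityI[of _ "{0..m}"]) (simp_all add: split_collection_def)
  ultimately show ?thesis
    by (simp add: p prod_eq_iff)
qed

text \<open>
  Up to \<open>i\<close> the entry \<open>S i\<close> is determined by its defect, and above \<open>i\<close> by its excess. Since the
  defect of a pair lies in \<open>{1..i}\<close> and its excess in \<open>{i + 1..m}\<close>, nothing is lost in either
  direction.
\<close>

lemma bij_betw_split_collection:
  "bij_betw (split_collection m) (genocchi_collections m)
     (\<Union>f\<in>motzkin_paths m. defect_excess_pairs m f)"
proof (rule bij_betw_byWitness[where f' = "merge_pair m"])
  show "\<forall>S\<in>genocchi_collections m. merge_pair m (split_collection m S) = S"
    by (simp add: merge_split_collection)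
  show "\<forall>p\<in>\<Union>f\<in>motzkin_paths m. defect_excess_pairs m f. split_collection m (merge_pair m p) = p"
    by (auto simp: split_merge_pair)
  show "split_collection m ` genocchi_collections m
      \<subseteq> (\<Union>f\<in>motzkin_paths m. defect_excess_pairs m f)"
    by (simp add: image_subset_iff split_collection_mem)
  show "merge_pair m ` (\<Union>f\<in>motzkin_paths m. defect_excess_pairs m f) \<subseteq> genocchi_collections m"
    by (auto simp: merge_pair_mem)
qed

text \<open>The path is recovered from a pair as the cardinalities of its first component.\<close>

lemma disjoint_defect_excess_pairs:
  assumes "f \<in> motzkin_paths m" "g \<in> motzkin_paths m" "f \<noteq> g"
  shows "defect_excess_pairs m f \<inter> defect_excess_pairs m g = {}"
proof (rule ccontr)
  assume "defect_excess_pairs m f \<inter> defect_excess_pairs m g \<noteq> {}"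
  then obtain B where "B \<in> slow_chains Suc m f" "B \<in> slow_chains Suc m g"
    by (auto simp: defect_excess_pairs_def)
  then have "f i = g i" if "i \<in> {0..m}" for i
    using that by (simp add: slow_chains_def)
  moreover have "f \<in> extensional {0..m}" "g \<in> extensional {0..m}"
    using assms(1,2) by (auto simp: motzkin_paths_def PiE_def)
  ultimately have "f = g" by (rule extensionalityI[rotated 2])
  with assms(3) show False by contradiction
qed

section \<open>The weight of a path\<close>

lemma card_defect_excess_pairs:
  assumes "f \<in> motzkin_paths m"
  shows "finite (defect_excess_pairs m f)"
    and "card (defect_excess_pairs m f) =
      (\<Prod>i<m. ((f i + 1) choose f (Suc i)) * ((f (Suc i) + 1) choose f i))"
proof -
  have f: "f 0 = 0" "f m = 0"
    using assms by (auto simp: motzkin_paths_def)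
  have B: "finite (slow_chains Suc m f) \<and>
      card (slow_chains Suc m f) = (\<Prod>i<m. (f i + 1) choose f (Suc i))"
    using f by (intro card_slow_chains) auto
  have T: "finite (slow_chains (\<lambda>j. m - j) m (\<lambda>j. f (m - j))) \<and>
      card (slow_chains (\<lambda>j. m - j) m (\<lambda>j. f (m - j))) =
        (\<Prod>j<m. (f (m - j) + 1) choose f (m - Suc j))"
    using f by (intro card_slow_chains) (auto simp: inj_on_def)
  have "(\<Prod>j<m. (f (m - j) + 1) choose f (m - Suc j)) =
      (\<Prod>j<m. (f (Suc (m - Suc j)) + 1) choose f (m - Suc j))"
    by (intro prod.cong) (auto simp: Suc_diff_Suc)
  also have "\<dots> = (\<Prod>i<m. (f (Suc i) + 1) choose f i)"
    \<comment> \<open>Undo the backward reading of the excesses.\<close>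
    by (rule prod.nat_diff_reindex)
  finally show "card (defect_excess_pairs m f) =
      (\<Prod>i<m. ((f i + 1) choose f (Suc i)) * ((f (Suc i) + 1) choose f i))"
    using B T by (simp add: defect_excess_pairs_def card_cartesian_product prod.distrib)
  show "finite (defect_excess_pairs m f)"
    using B T by (simp add: defect_excess_pairs_def)
qed

lemma Suc_choose_Suc_Suc: "real (Suc (Suc a) choose a) = (1 + real a) * (2 + real a) / 2"
proof -
  have "Suc (Suc a) choose a = Suc (Suc a) choose 2"
    using binomial_symmetric[of a "Suc (Suc a)"] by (simp add: numeral_2_eq_2)
  then show ?thesis
    by (simp add: choose_two real_of_nat_div algebra_simps)
qed

text \<open>
  For a level step both factors are \<open>a + 1\<close>. Otherwise one of them is \<open>1\<close>, and the other is the
  number of two-element subsets of a set with \<open>max a b + 1\<close> elements.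
\<close>

lemma step_weight:
  fixes a b :: nat
  assumes "int b - int a \<in> {-1, 0, 1}"
  shows "real (((a + 1) choose b) * ((b + 1) choose a)) =
    (1 + real a) * (1 + real b) / (if a = b then 1 else 2)"
proof -
  consider "b = a" | "b = Suc a" | "a = Suc b"
    using assms by fastforce
  then show ?thesis
    using Suc_choose_Suc_Suc[of a] Suc_choose_Suc_Suc[of b] by cases (simp_all add: algebra_simps)
qed

lemma num_rises_falls_eq_card:
  assumes "f \<in> motzkin_paths N"
  shows "num_rises_falls N f = card {i \<in> {..<N}. f i \<noteq> f (Suc i)}"
proof -
  have "int (f (Suc i)) - int (f i) \<in> {-1, 0, 1}" if "i < N" for i
    using assms that by (simp add: motzkin_paths_def)
  then have "{i \<in> {..<N}. f i \<noteq> f (Suc i)} = rises N f \<union> falls N f"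
    by (fastforce simp: rises_def falls_def)
  moreover have "card (rises N f \<union> falls N f) = card (rises N f) + card (falls N f)"
    by (intro card_Un_disjoint) (auto simp: rises_def falls_def)
  ultimately show ?thesis by (simp add: num_rises_falls_def)
qed

lemma path_weight:
  assumes "f \<in> motzkin_paths (n + 1)"
  shows "real (card (defect_excess_pairs (n + 1) f)) =
    (\<Prod>k=1..n. (1 + real (f k))^2) / 2 ^ num_rises_falls (n + 1) f"
proof -
  let ?w = "\<lambda>i. 1 + real (f i)"
  have f: "f 0 = 0" "f (Suc n) = 0"
    and step: "\<And>i. i < Suc n \<Longrightarrow> int (f (Suc i)) - int (f i) \<in> {-1, 0, 1}"
    using assms by (auto simp: motzkin_paths_def)
  have "real (card (defect_excess_pairs (n + 1) f)) =
      (\<Prod>i<Suc n. real (((f i + 1) choose f (Suc i)) * ((f (Suc i) + 1) choose f i)))"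
    unfolding card_defect_excess_pairs(2)[OF assms] of_nat_prod by simp
  also have "\<dots> = (\<Prod>i<Suc n. ?w i * ?w (Suc i) / (if f i = f (Suc i) then 1 else 2))"
    by (rule prod.cong[OF refl], rule step_weight, rule step) simp
  also have "\<dots> = (\<Prod>i<Suc n. ?w i) * (\<Prod>i<Suc n. ?w (Suc i)) /
      (\<Prod>i<Suc n. if f i = f (Suc i) then 1 else 2)"
    by (simp add: prod.distrib prod_dividef)
  also have "(\<Prod>i<Suc n. if f i = f (Suc i) then 1 else (2::real)) =
      (\<Prod>i\<in>{i \<in> {..<Suc n}. f i \<noteq> f (Suc i)}. 2)"
    by (subst prod.inter_filter) (auto intro!: prod.cong)
  also have "\<dots> = 2 ^ num_rises_falls (n + 1) f"
    using num_rises_falls_eq_card[OF assms] by simp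
  \<comment> \<open>The two products over steps differ from the one over inner heights by the factors of the
    end heights \<open>f 0 = 0\<close> and \<open>f (n + 1) = 0\<close>, which are \<open>1\<close>.\<close>
  also have "(\<Prod>i<Suc n. ?w i) = (\<Prod>k=1..n. ?w k)"
    using f by (simp add: prod.lessThan_Suc_shift prod.atLeast1_atMost_eq del: prod.lessThan_Suc)
  also have "(\<Prod>i<Suc n. ?w (Suc i)) = (\<Prod>k=1..n. ?w k)"
    using f by (simp add: prod.atLeast1_atMost_eq)
  finally show ?thesis
    by (simp add: power2_eq_square prod.distrib)
qed

theorem corollary6p6:
  fixes n :: nat
  assumes "n \<ge> 1"
  shows "real (normalized_median_genocchi (n + 1)) =
    (\<Sum>f\<in>motzkin_paths (n + 1).
       (\<Prod>k=1..n. (1 + real (f k))^2) / 2 ^ num_rises_falls (n + 1) f)"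
proof -
  have "normalized_median_genocchi (n + 1) =
      card (\<Union>f\<in>motzkin_paths (n + 1). defect_excess_pairs (n + 1) f)"
    unfolding normalized_median_genocchi_def
    by (rule bij_betw_same_card[OF bij_betw_split_collection])
  also have "\<dots> = (\<Sum>f\<in>motzkin_paths (n + 1). card (defect_excess_pairs (n + 1) f))"
    using finite_motzkin_paths card_defect_excess_pairs(1) disjoint_defect_excess_pairs
    by (intro card_UN_disjoint) auto
  finally have "real (normalized_median_genocchi (n + 1)) =
      (\<Sum>f\<in>motzkin_paths (n + 1). real (card (defect_excess_pairs (n + 1) f)))"
    by simp
  also have "\<dots> = (\<Sum>f\<in>motzkin_paths (n + 1).
      (\<Prod>k=1..n. (1 + real (f k))^2) / 2 ^ num_rises_falls (n + 1) f)"
    by (rule sum.cong[OF refl path_weight])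
  finally show ?thesis .
qed

end
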